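(* Let $S$ be a semigroup. (1) If $S$ is a completely simple semigroup that is a band, i.e. $S\cong\mathcal{M}(\{e\},I,\Lambda;P)$ for some non-empty sets $I$ and $\Lambda$ and a sandwich matrix $P$ all of whose entries are $e$, then the lower non-nilpotent graph $\mathcal{L}_S$ is complete. (2) If $S$ has prime order (as a finite set) and $\mathcal{L}_S$ is connected, then $\mathcal{L}_S$ is complete.
   Context: For a semigroup $S$, $S^1$ denotes $S$ if $S$ has an identity, and otherwise $S$ with an identity $1$ adjoined. For $x,y\in S$ and $z_1,z_2,\ldots\in S^1$ define recursively $\lambda_0=x$, $\rho_0=y$, $\lambda_{n+1}=\lambda_n z_{n+1}\rho_n$, $\rho_{n+1}=\rho_n z_{n+1}\lambda_n$; write $\lambda_n(x,y,z_1,\ldots,z_n)$, $\rho_n(x,y,z_1,\ldots,z_n)$. The lower non-nilpotent graph $\mathcal{L}_S$ has vertex set $S$, and distinct $x,y\in S$ are adjacent iff there are $n\ge 1$ and $w_1,\ldots,w_n\in\langle x,y\rangle^1$ with $x=\lambda_n(x,y,w_1,\ldots,w_n)$ and $y=\rho_n(x,y,w_1,\ldots,w_n)$, where $\langle x,y\rangle$ is the subsemigroup generated by $x,y$. A graph is complete if every two distinct vertices are adjacent. A band is a semigroup all of whose elements are idempotent. $\mathcal{M}(\{e\},I,\Lambda;P)$ is the Rees matrix semigroup over the trivial group $\{e\}$ (elements $e_{ij}$, $i\in I$, $j\in\Lambda$, with $e_{ij}e_{kl}=e_{il}$). *)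

theory Defs
  imports
    "HOL-Algebra.Elementary_Groups"
    "HOL-Computational_Algebra.Primes"
    "Graph_Theory.Digraph_Component"
begin

text \<open>The ambient semigroup \<open>S\<close> is a type \<open>'a\<close> of class \<open>semigroup_mult\<close>.\<close>

definition subsemigroup :: "'a::semigroup_mult set \<Rightarrow> bool" where
  "subsemigroup T \<longleftrightarrow> (\<forall>a\<in>T. \<forall>b\<in>T. a * b \<in> T)"

definition generated_subsemigroup :: "'a::semigroup_mult set \<Rightarrow> 'a set" where
  "generated_subsemigroup X = subsemigroup hull X"

definition has_identity :: "'a::semigroup_mult set \<Rightarrow> bool" where
  "has_identity T \<longleftrightarrow> (\<exists>u\<in>T. \<forall>t\<in>T. u * t = t \<and> t * u = t)"

text \<open>
  The semigroup \<open>T\<^sup>1\<close> is encoded in \<open>'a option\<close>: \<open>Some t\<close> stands for the element \<open>t\<close>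
  of \<open>T\<close>, and \<open>None\<close> for the adjoined identity, which is present only if \<open>T\<close> has no
  identity of its own.
\<close>

definition with_one :: "'a::semigroup_mult set \<Rightarrow> 'a option set" where
  "with_one T = (if has_identity T then Some ` T else insert None (Some ` T))"

text \<open>The product \<open>a z b\<close>, where \<open>z\<close> may be the adjoined identity.\<close>

fun product3 :: "'a::semigroup_mult \<Rightarrow> 'a option \<Rightarrow> 'a \<Rightarrow> 'a" where
  "product3 a None b = a * b"
| "product3 a (Some c) b = a * c * b"

text \<open>
  \<open>lambda_seq x y z n\<close> is \<open>\<lambda>\<^sub>n(x, y, z\<^sub>1, \<dots>, z\<^sub>n)\<close>, with \<open>z i\<close> for \<open>z\<^sub>i\<close>; the value \<open>z 0\<close> and
  the values \<open>z i\<close> with \<open>i > n\<close> are not used. Similarly for \<open>rho_seq\<close>.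
\<close>

fun lambda_seq :: "'a::semigroup_mult \<Rightarrow> 'a \<Rightarrow> (nat \<Rightarrow> 'a option) \<Rightarrow> nat \<Rightarrow> 'a"
  and rho_seq :: "'a::semigroup_mult \<Rightarrow> 'a \<Rightarrow> (nat \<Rightarrow> 'a option) \<Rightarrow> nat \<Rightarrow> 'a" where
  "lambda_seq x y z 0 = x"
| "rho_seq x y z 0 = y"
| "lambda_seq x y z (Suc n) =
     product3 (lambda_seq x y z n) (z (Suc n)) (rho_seq x y z n)"
| "rho_seq x y z (Suc n) =
     product3 (rho_seq x y z n) (z (Suc n)) (lambda_seq x y z n)"

definition lower_adjacent :: "'a::semigroup_mult \<Rightarrow> 'a \<Rightarrow> bool" where
  "lower_adjacent x y \<longleftrightarrow> x \<noteq> y \<and>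
     (\<exists>n\<ge>1. \<exists>w. (\<forall>i\<in>{1..n}. w i \<in> with_one (generated_subsemigroup {x, y})) \<and>
        x = lambda_seq x y w n \<and> y = rho_seq x y w n)"

text \<open>
  The relation \<^const>\<open>lower_adjacent\<close> is symmetric, since exchanging \<open>x\<close> and \<open>y\<close> exchanges
  the two sequences; the undirected graph is represented by its set of ordered pairs of
  adjacent vertices.
\<close>

definition lower_non_nilpotent_graph :: "'a::semigroup_mult pair_pre_digraph" where
  "lower_non_nilpotent_graph = \<lparr> pverts = UNIV, parcs = {(x, y). lower_adjacent x y} \<rparr>"

text \<open>Unlike the library's \<^const>\<open>connected\<close>, its notion of complete graph is restricted to
  finite graphs.\<close>

definition complete_graph :: "('v, 'e) pre_digraph \<Rightarrow> bool" where
  "complete_graph G \<longleftrightarrow> (\<forall>u\<in>verts G. \<forall>v\<in>verts G. u \<noteq> v \<longrightarrow> (u, v) \<in> arcs_ends G)"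

definition band :: "'a::semigroup_mult itself \<Rightarrow> bool" where
  "band _ \<longleftrightarrow> (\<forall>x::'a. x * x = x)"

definition semigroup_ideal :: "'a::semigroup_mult set \<Rightarrow> bool" where
  "semigroup_ideal J \<longleftrightarrow> J \<noteq> {} \<and> (\<forall>a\<in>J. \<forall>s. s * a \<in> J \<and> a * s \<in> J)"

definition simple_semigroup :: "'a::semigroup_mult itself \<Rightarrow> bool" where
  "simple_semigroup _ \<longleftrightarrow> (\<forall>J::'a set. semigroup_ideal J \<longrightarrow> J = UNIV)"

text \<open>Minimality is with respect to the natural order of idempotents:
  \<open>g \<le> f\<close> iff \<open>f g = g = g f\<close>.\<close>

definition primitive_idempotent :: "'a::semigroup_mult \<Rightarrow> bool" where
  "primitive_idempotent f \<longleftrightarrow> f * f = f \<and>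
     (\<forall>g. g * g = g \<and> f * g = g \<and> g * f = g \<longrightarrow> g = f)"

definition completely_simple :: "'a::semigroup_mult itself \<Rightarrow> bool" where
  "completely_simple T \<longleftrightarrow> simple_semigroup T \<and> (\<exists>f::'a. primitive_idempotent f)"

text \<open>
  The Rees matrix semigroup \<open>\<M>(G, I, \<Lambda>; P)\<close> over a group \<open>G\<close>: the triple \<open>(i, g, j)\<close>
  stands for \<open>g\<^sub>i\<^sub>j\<close>, and the \<open>\<Lambda> \<times> I\<close> sandwich matrix has entries \<open>P j i\<close>.
\<close>

definition rees_carrier ::
    "('g, 'b) monoid_scheme \<Rightarrow> 'i set \<Rightarrow> 'l set \<Rightarrow> ('i \<times> 'g \<times> 'l) set" where
  "rees_carrier G I \<Lambda> = I \<times> carrier G \<times> \<Lambda>"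

fun rees_mult ::
    "('g, 'b) monoid_scheme \<Rightarrow> ('l \<Rightarrow> 'i \<Rightarrow> 'g) \<Rightarrow> 'i \<times> 'g \<times> 'l \<Rightarrow> 'i \<times> 'g \<times> 'l \<Rightarrow> 'i \<times> 'g \<times> 'l"
  where
  "rees_mult G P (i, g, j) (k, h, l) = (i, g \<otimes>\<^bsub>G\<^esub> P j k \<otimes>\<^bsub>G\<^esub> h, l)"

definition isomorphic_to_rees ::
    "'a::semigroup_mult itself \<Rightarrow> ('g, 'b) monoid_scheme \<Rightarrow> 'i set \<Rightarrow> 'l set \<Rightarrow>
      ('l \<Rightarrow> 'i \<Rightarrow> 'g) \<Rightarrow> bool" where
  "isomorphic_to_rees _ G I \<Lambda> P \<longleftrightarrow>
     (\<exists>\<phi>. bij_betw \<phi> (UNIV :: 'a set) (rees_carrier G I \<Lambda>) \<and>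
        (\<forall>x y. \<phi> (x * y) = rees_mult G P (\<phi> x) (\<phi> y)))"

end

theory Submission
  imports Defs
begin

text \<open>In a rectangular band \<open>x y x = x\<close>, so the constant choice \<open>w\<^sub>i = x\<close> gives \<open>\<lambda>\<^sub>2 = x\<close> and
  \<open>\<rho>\<^sub>2 = y\<close>.

  Adjacent elements generate the same two-sided ideal, so a connected graph forces \<open>S\<close> to be simple.
  If \<open>S\<close> is moreover finite, some idempotent \<open>e\<close> has a group \<open>e S e\<close> as its local submonoid, whose
  order divides \<open>|S|\<close> by the Rees coordinatization. For \<open>|S|\<close> prime, either \<open>e S e\<close> is trivial and
  \<open>S\<close> is a rectangular band, or \<open>S = e S e\<close> is a commutative group; in the latter case
  \<open>\<lambda>\<^sub>n = \<rho>\<^sub>n\<close> for all \<open>n \<ge> 1\<close>, so that there are no edges at all.\<close>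

section \<open>Rectangular bands\<close>

lemma generated_subsemigroup_contains: "X \<subseteq> generated_subsemigroup X"
  unfolding generated_subsemigroup_def by (rule hull_subset)

lemma lower_adjacent_if_rectangular:
  fixes x y :: "'a::semigroup_mult"
  assumes rect: "\<And>a b :: 'a. a * b * a = a" and "x \<noteq> y"
  shows "lower_adjacent x y"
proof -
  let ?w = "\<lambda>_::nat. Some x"
  have idem: "a * a = a" for a :: 'a
    by (metis rect mult.assoc)
  have absorb: "a * b * (c * a) = a" for a b c :: 'a
    by (metis rect mult.assoc)
  \<comment> \<open>By idempotence the terms at index 1 are \<open>x * y\<close> and
    \<open>y * x\<close>; one more round yields products that begin and end with \<open>x\<close>,
    respectively with \<open>y\<close>.\<close>
  have "lambda_seq x y ?w 2 = x" "rho_seq x y ?w 2 = y"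
    by (simp_all add: numeral_2_eq_2 absorb idem) (metis idem absorb mult.assoc)+
  moreover have "x \<in> generated_subsemigroup {x, y}"
    using generated_subsemigroup_contains[of "{x, y}"] by auto
  then have "\<forall>i\<in>{1..2}. ?w i \<in> with_one (generated_subsemigroup {x, y})"
    by (auto simp: with_one_def)
  ultimately show ?thesis
    unfolding lower_adjacent_def using \<open>x \<noteq> y\<close>
    by (metis one_le_numeral)
qed

lemma complete_graph_if_rectangular:
  assumes "\<And>a b :: 'a::semigroup_mult. a * b * a = a"
  shows "complete_graph (with_proj (lower_non_nilpotent_graph :: 'a pair_pre_digraph))"
  using lower_adjacent_if_rectangular[OF assms]
  by (simp add: complete_graph_def lower_non_nilpotent_graph_def)

text \<open>Writing \<open>x = a * e * b\<close> leaves \<open>e * (b * y * a) * e\<close> inside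
  \<open>x * y * x\<close>, and this collapses to \<open>e\<close>. Serves both the simple bands and
  the prime-order case with trivial local group.\<close>

lemma rectangular_if_local_trivial:
  fixes e x y :: "'a::semigroup_mult"
  assumes "\<And>s. e * s * e = e" and "\<And>s. \<exists>a b. s = a * e * b"
  shows "x * y * x = x"
proof -
  obtain a b where x: "x = a * e * b"
    using assms(2) by blast
  have "x * y * x = a * (e * (b * y * a) * e) * b"
    by (simp add: x mult.assoc)
  then show ?thesis
    by (simp only: assms(1) x)
qed

text \<open>The ideal \<open>S e S\<close>; for idempotent \<open>e\<close> it contains
  \<open>e = e * e * e\<close>. Once it is all of \<open>S\<close>, every element factors through
  \<open>e\<close>.\<close>

lemma semigroup_ideal_principal: "semigroup_ideal {a * e * b | a b. True}"
proof -
  have "s * (a * e * b) = s * a * e * b" "a * e * b * s = a * e * (b * s)" for s a b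
    by (simp_all add: mult.assoc)
  then show ?thesis
    unfolding semigroup_ideal_def by blast
qed

lemma rectangular_if_completely_simple_band:
  fixes x y :: "'a::semigroup_mult"
  assumes "completely_simple TYPE('a)" and "band TYPE('a)"
  shows "x * y * x = x"
proof -
  have idem: "a * a = a" for a :: 'a
    using assms(2) by (simp add: band_def)
  obtain e :: 'a where prim: "\<And>g. g * g = g \<Longrightarrow> e * g = g \<Longrightarrow> g * e = g \<Longrightarrow> g = e"
    and simp: "simple_semigroup TYPE('a)"
    using assms(1) unfolding completely_simple_def primitive_idempotent_def by blast
  \<comment> \<open>In a band \<open>e * s * e\<close> is an idempotent, and it lies below
    \<open>e\<close> in the natural order.\<close>
  have "e * s * e = e" for s
    by (rule prim) (metis idem mult.assoc)+
  moreover have "\<exists>a b. s = a * e * b" for s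
    using simp semigroup_ideal_principal[of e] unfolding simple_semigroup_def by blast
  ultimately show ?thesis
    by (rule rectangular_if_local_trivial)
qed

lemma rectangular_if_trivial_rees:
  fixes x y :: "'a::semigroup_mult"
  assumes "isomorphic_to_rees TYPE('a) (singleton_group e) I \<Lambda> P"
  shows "x * y * x = x"
proof -
  obtain \<phi> :: "'a \<Rightarrow> _" where bij: "bij_betw \<phi> UNIV (rees_carrier (singleton_group e) I \<Lambda>)"
    and hom: "\<And>x y. \<phi> (x * y) = rees_mult (singleton_group e) P (\<phi> x) (\<phi> y)"
    using assms unfolding isomorphic_to_rees_def by blast
  have form: "\<exists>i j. \<phi> s = (i, e, j)" for s
    using bij_betwE[OF bij, rule_format, of s] by (auto simp: rees_carrier_def)
  obtain i j k l where "\<phi> x = (i, e, j)" "\<phi> y = (k, e, l)"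
    using form by meson
  \<comment> \<open>Multiplication in \<open>singleton_group e\<close> is constantly
    \<open>e\<close>, and the outer indices come from the two outer factors, both
    \<open>x\<close>.\<close>
  then have "\<phi> (x * y * x) = \<phi> x"
    by (simp add: hom singleton_group_def)
  then show ?thesis
    using bij by (metis bij_betw_imp_inj_on injD)
qed

section \<open>Ideals and paths in the graph\<close>

text \<open>From index 1 on, every term has both \<open>x\<close> and \<open>y\<close> among its
  factors; at index 0 one of the two may lie outside \<open>J\<close>, hence
  \<open>Suc n\<close>.\<close>

lemma seq_mem_ideal:
  assumes "semigroup_ideal J" and "x \<in> J \<or> y \<in> J"
  shows "lambda_seq x y w (Suc n) \<in> J \<and> rho_seq x y w (Suc n) \<in> J"
proof -
  have product3_mem: "product3 a z b \<in> J" if "a \<in> J \<or> b \<in> J" for a b z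
    using that assms(1) unfolding semigroup_ideal_def by (cases z) auto
  show ?thesis
    by (induction n) (use assms(2) product3_mem in auto)
qed

lemma lower_adjacent_ideal:
  assumes "lower_adjacent x y" and "semigroup_ideal J"
  shows "x \<in> J \<longleftrightarrow> y \<in> J"
proof -
  obtain n w where "x = lambda_seq x y w (Suc n)" "y = rho_seq x y w (Suc n)"
    using assms(1) unfolding lower_adjacent_def by (metis Suc_le_D One_nat_def)
  then show ?thesis
    using seq_mem_ideal[OF assms(2)] by metis
qed

lemma not_lower_adjacent_if_commutative:
  fixes x y :: "'a::semigroup_mult"
  assumes comm: "\<And>a b :: 'a. a * b = b * a"
  shows "\<not> lower_adjacent x y"
proof
  assume "lower_adjacent x y"
  then obtain n w where "x \<noteq> y" "x = lambda_seq x y w (Suc n)" "y = rho_seq x y w (Suc n)"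
    unfolding lower_adjacent_def by (metis Suc_le_D One_nat_def)
  \<comment> \<open>The two recursions differ only by exchanging the outer factors.\<close>
  moreover have "product3 a z b = product3 b z a" for a b :: 'a and z
    by (cases z) (simp_all, metis comm, metis comm mult.assoc)
  then have "lambda_seq x y w (Suc n) = rho_seq x y w (Suc n)"
    by simp
  ultimately show False
    by simp
qed

text \<open>Connectedness is strong connectedness of the symmetrised graph, so a path may traverse
  an arc in either direction; an equivalence in \<open>step\<close> covers both.\<close>

lemma connected_induct:
  assumes "Digraph_Component.connected
      (with_proj (lower_non_nilpotent_graph :: 'a::semigroup_mult pair_pre_digraph))"
    and "P x" and step: "\<And>u v :: 'a. lower_adjacent u v \<Longrightarrow> P u \<longleftrightarrow> P v"
  shows "P y"
proof -
  let ?G = "with_proj (lower_non_nilpotent_graph :: 'a pair_pre_digraph)"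
  have "x \<rightarrow>\<^sup>*\<^bsub>with_proj (mk_symmetric ?G)\<^esub> y"
    using assms(1)
    by (auto simp: Digraph_Component.connected_def strongly_connected_def
        lower_non_nilpotent_graph_def)
  then have "(x, y) \<in> rtrancl_on UNIV (parcs (mk_symmetric ?G))"
    by (simp add: reachable_def lower_non_nilpotent_graph_def)
  then show ?thesis
    using \<open>P x\<close>
  proof induction
    case (step u v)
    then have "lower_adjacent u v \<or> lower_adjacent v u"
      by (auto simp: parcs_mk_symmetric lower_non_nilpotent_graph_def arcs_ends_def
          arc_to_ends_def)
    then show ?case
      using step assms(3) by blast
  qed
qed

section \<open>Local groups of finite semigroups\<close>

text \<open>A minimal right ideal \<open>R\<close> and a minimal left ideal \<open>L\<close> satisfy
  \<open>a R = R\<close> and \<open>L a = L\<close> for \<open>a \<in> R \<inter> L\<close>, so translations by such \<open>a\<close> permute \<open>R L\<close>.\<close>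

lemma finite_semigroup_local_group:
  assumes "finite (UNIV :: 'a::semigroup_mult set)"
  obtains e :: "'a::semigroup_mult" where "e * e = e"
    and "\<And>s. \<exists>h. e * h = h \<and> h * e = h \<and> e * s * h = e \<and> h * s * e = e"
proof -
  \<comment> \<open>Minimality is obtained from least cardinality, which exists by well-ordering of
    the naturals.\<close>
  let ?Lideal = "\<lambda>M :: 'a set. M \<noteq> {} \<and> (\<forall>s. \<forall>a\<in>M. s * a \<in> M)"
  have "?Lideal UNIV"
    by simp
  then have "\<exists>L. ?Lideal L \<and> (\<forall>M. ?Lideal M \<longrightarrow> card L \<le> card M)"
    by (rule ex_has_least_nat)
  then obtain L where L': "?Lideal L \<and> (\<forall>M. ?Lideal M \<longrightarrow> card L \<le> card M)"
    by (rule exE)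
  have "L \<noteq> {}"
    using L' by simp
  have L: "s * a \<in> L" if "a \<in> L" for a s
    using L' that by simp
  have minL: "card L \<le> card M" if "M \<noteq> {}" "\<forall>s. \<forall>a\<in>M. s * a \<in> M" for M :: "'a set"
    using L'[THEN conjunct2, rule_format, of M] that by simp
  let ?Rideal = "\<lambda>M :: 'a set. M \<noteq> {} \<and> (\<forall>s. \<forall>a\<in>M. a * s \<in> M)"
  have "?Rideal UNIV"
    by simp
  then have "\<exists>R. ?Rideal R \<and> (\<forall>M. ?Rideal M \<longrightarrow> card R \<le> card M)"
    by (rule ex_has_least_nat)
  then obtain R where R': "?Rideal R \<and> (\<forall>M. ?Rideal M \<longrightarrow> card R \<le> card M)"
    by (rule exE)
  have "R \<noteq> {}"
    using R' by simp
  have R: "a * s \<in> R" if "a \<in> R" for a s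
    using R' that by simp
  have minR: "card R \<le> card M" if "M \<noteq> {}" "\<forall>s. \<forall>a\<in>M. a * s \<in> M" for M :: "'a set"
    using R'[THEN conjunct2, rule_format, of M] that by simp
  have fin: "finite X" for X :: "'a set"
    using assms by (rule finite_subset[OF subset_UNIV])
  \<comment> \<open>\<open>L a\<close> is a left ideal inside \<open>L\<close>, so least cardinality
    forces equality.\<close>
  have La: "(\<lambda>x. x * a) ` L = L" if "a \<in> L" for a
  proof (rule card_seteq[OF fin])
    show "card L \<le> card ((\<lambda>x. x * a) ` L)"
      by (rule minL) (use \<open>L \<noteq> {}\<close> L in \<open>auto simp: mult.assoc[symmetric]\<close>)
  qed (use L that in auto)
  have aR: "(*) a ` R = R" if "a \<in> R" for a
  proof (rule card_seteq[OF fin])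
    show "card R \<le> card ((*) a ` R)"
      by (rule minR) (use \<open>R \<noteq> {}\<close> R in \<open>auto simp: mult.assoc\<close>)
  qed (use R that in auto)
  \<comment> \<open>\<open>H\<close> turns out to be the group \<open>e S e\<close>:
    \<open>left\<close> and \<open>right\<close> solve all linear equations within it.\<close>
  define H where "H = {r * l | r l. r \<in> R \<and> l \<in> L}"
  have H_ideals: "a \<in> R \<and> a \<in> L" if "a \<in> H" for a
    using that L R by (auto simp: H_def)
  have left: "\<exists>x\<in>H. a * x = b" if "a \<in> H" "b \<in> H" for a b
  proof -
    obtain r l where "b = r * l" "r \<in> R" "l \<in> L"
      using \<open>b \<in> H\<close> by (auto simp: H_def)
    moreover obtain r' where "r' \<in> R" "r = a * r'"
      using aR[of a] H_ideals[OF \<open>a \<in> H\<close>] \<open>r \<in> R\<close> by blast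
    ultimately show ?thesis
      by (auto simp: H_def mult.assoc)
  qed
  have right: "\<exists>x\<in>H. x * a = b" if "a \<in> H" "b \<in> H" for a b
  proof -
    obtain r l where "b = r * l" "r \<in> R" "l \<in> L"
      using \<open>b \<in> H\<close> by (auto simp: H_def)
    moreover obtain l' where "l' \<in> L" "l = l' * a"
      using La[of a] H_ideals[OF \<open>a \<in> H\<close>] \<open>l \<in> L\<close> by blast
    ultimately show ?thesis
      by (auto simp: H_def mult.assoc[symmetric])
  qed
  obtain a where "a \<in> H"
    using \<open>L \<noteq> {}\<close> \<open>R \<noteq> {}\<close> by (auto simp: H_def)
  then obtain e where "e \<in> H" "e * a = a"
    using right by blast
  \<comment> \<open>Each \<open>b\<close> in \<open>H\<close> has the form \<open>a * x\<close>, so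
    \<open>e * a = a\<close> carries over to \<open>b\<close>. For \<open>er\<close>, write
    \<open>b = x * e\<close> instead.\<close>
  have el: "e * b = b" if "b \<in> H" for b
    using left[OF \<open>a \<in> H\<close> that] \<open>e * a = a\<close> by (auto simp: mult.assoc[symmetric])
  have er: "b * e = b" if "b \<in> H" for b
    using right[OF \<open>e \<in> H\<close> that] el[OF \<open>e \<in> H\<close>] by (auto simp: mult.assoc)
  have ese: "e * s * e \<in> H" for s
    using H_ideals[OF \<open>e \<in> H\<close>] L unfolding H_def by (auto simp: mult.assoc)
  show ?thesis
  proof
    show "e * e = e"
      by (rule el[OF \<open>e \<in> H\<close>])
    fix s
    let ?g = "e * s * e"
    obtain h where "h \<in> H" "?g * h = e"
      using left[OF ese \<open>e \<in> H\<close>] by blast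
    moreover obtain k where "k \<in> H" "k * ?g = e"
      using right[OF ese \<open>e \<in> H\<close>] by blast
    moreover have "k * (?g * h) = k * ?g * h"
      by (simp add: mult.assoc)
    ultimately have "h = k"
      using el er by simp
    have "e * s * h = ?g * h"
      using el[OF \<open>h \<in> H\<close>] by (simp add: mult.assoc)
    moreover have "h * s * e = h * ?g"
      using er[OF \<open>h \<in> H\<close>] by (simp add: mult.assoc[symmetric])
    ultimately show "\<exists>h. e * h = h \<and> h * e = h \<and> e * s * h = e \<and> h * s * e = e"
      using \<open>h \<in> H\<close> \<open>?g * h = e\<close> \<open>k * ?g = e\<close> \<open>h = k\<close> el er by auto
  qed
qed

text \<open>The bijection \<open>(i, g, j) \<mapsto> i g j\<close> is the Rees coordinatization; \<open>i\<close> and \<open>j\<close> are recovered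
  from \<open>s\<close> as \<open>s h\<close> and \<open>h s\<close>, where \<open>h\<close> is the inverse of \<open>e s e\<close> in the group \<open>e S e\<close>.\<close>

lemma local_group_card_dvd:
  fixes e :: "'a::semigroup_mult"
  assumes e: "e * e = e"
    and inv: "\<And>s. \<exists>h. e * h = h \<and> h * e = h \<and> e * s * h = e \<and> h * s * e = e"
    and simple: "\<And>s. \<exists>a b. s = a * e * b"
  shows "card (range (\<lambda>s. e * s * e)) dvd card (UNIV :: 'a set)"
proof -
  \<comment> \<open>The index sets are the idempotents L-related and R-related to \<open>e\<close>
    in Green's sense: \<open>i * i = i * e * i = i * e = i\<close>, and dually for
    \<open>j\<close>.\<close>
  let ?A = "{i. i * e = i \<and> e * i = e}" and ?B = "{j. e * j = j \<and> j * e = e}"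
  let ?G = "range (\<lambda>s. e * s * e)"
  let ?f = "\<lambda>(i, g, j). i * g * j"
  \<comment> \<open>Recovers the group coordinate of \<open>i g j\<close>.\<close>
  have middle: "e * (i * (e * s * e) * j) * e = e * s * e"
    if "e * i = e" "j * e = e" for i s j
  proof -
    have "e * (i * (e * s * e) * j) * e = e * i * e * s * e * (j * e)"
      by (simp add: mult.assoc)
    then show ?thesis
      by (simp add: that e) (simp add: mult.assoc e)
  qed
  have outer: "i * (e * s * e) * j * h = i" "h * (i * (e * s * e) * j) = j"
    if i: "i * e = i" "e * i = e" and j: "e * j = j" "j * e = e"
      and h: "e * h = h" "h * e = h" "e * s * h = e" "h * s * e = e" for i s j h
  proof -
    have "j * h = j * e * h" "h * i = h * (e * i)"
      by (simp_all add: mult.assoc h(1)) (simp add: mult.assoc[symmetric] h(2))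
    then have jh: "j * h = h" and hi: "h * i = h"
      by (simp_all add: i j h)
    have "i * (e * s * e) * j * h = i * (e * s * (e * (j * h)))"
      by (simp add: mult.assoc)
    then show "i * (e * s * e) * j * h = i"
      by (simp add: jh h i)
    have "h * (i * (e * s * e) * j) = h * i * e * s * e * j"
      by (simp add: mult.assoc)
    then show "h * (i * (e * s * e) * j) = j"
      by (simp add: hi h j)
  qed
  have "inj_on ?f (?A \<times> ?G \<times> ?B)"
  proof (rule inj_onI)
    fix p p' assume p: "p \<in> ?A \<times> ?G \<times> ?B" "p' \<in> ?A \<times> ?G \<times> ?B" "?f p = ?f p'"
    from p(1) obtain i s j where ps: "p = (i, e * s * e, j)"
      and i: "i * e = i" "e * i = e" and j: "e * j = j" "j * e = e"
      by blast
    from p(2) obtain i' s' j' where ps': "p' = (i', e * s' * e, j')"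
      and i': "i' * e = i'" "e * i' = e" and j': "e * j' = j'" "j' * e = e"
      by blast
    let ?g = "e * s * e" and ?g' = "e * s' * e"
    have eq: "i * ?g * j = i' * ?g' * j'"
      using p(3) unfolding ps ps' by simp
    have g: "?g = ?g'"
      using middle[OF i(2) j(2), of s] middle[OF i'(2) j'(2), of s'] unfolding eq by simp
    obtain h where h: "e * h = h" "h * e = h" "e * s * h = e" "h * s * e = e"
      using inv by blast
    have "i * ?g * j = i' * ?g * j'"
      using eq g by simp
    then have "i = i'" "j = j'"
      using outer[OF i j h] outer[OF i' j' h] by simp_all
    then show "p = p'"
      using ps ps' g by simp
  qed
  moreover have "s \<in> ?f ` (?A \<times> ?G \<times> ?B)" for s
  proof -
    obtain h where h: "e * h = h" "h * e = h" "e * s * h = e" "h * s * e = e"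
      using inv by blast
    obtain a b where s: "s = a * e * b"
      using simple by blast
    obtain u where u: "e * u = u" "u * e = u" "e * a * u = e" "u * a * e = e"
      using inv by blast
    obtain v where v: "e * v = v" "v * e = v" "e * b * v = e" "v * b * e = e"
      using inv by blast
    \<comment> \<open>Since \<open>e * s * e\<close> is the product of \<open>e * a * e\<close> and
      \<open>e * b * e\<close>, its inverse \<open>h\<close> must be \<open>v * u\<close>. This
      makes \<open>s * h * s = s\<close>.\<close>
    have "h = h * (e * a * u)"
      by (simp add: u h)
    also have "\<dots> = h * a * (e * u)"
      by (simp add: mult.assoc[symmetric] h) (simp add: mult.assoc u)
    also have "\<dots> = h * a * (e * b * v * u)"
      by (simp add: v)
    also have "\<dots> = h * s * (e * v) * u"
      by (simp add: s v(1)) (simp add: mult.assoc)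
    also have "\<dots> = h * s * e * v * u"
      by (simp add: mult.assoc)
    also have "\<dots> = v * u"
      by (simp add: h v)
    finally have "s * h * s = a * (e * b * v) * (u * a * e) * b"
      by (simp add: s mult.assoc)
    also have "\<dots> = a * (e * e) * b"
      by (simp only: u v) (simp only: mult.assoc)
    finally have shs: "s * h * s = s"
      by (simp add: e s)
    \<comment> \<open>Using \<open>s * h * s = s\<close> twice shows that the proposed coordinates
      reproduce \<open>s\<close>.\<close>
    have "s * h * (e * s * e) * (h * s) = s * (h * e) * s * (e * h) * s"
      by (simp add: mult.assoc)
    also have "\<dots> = s"
      by (simp add: h shs)
    finally have "s = s * h * (e * s * e) * (h * s)" ..
    then have "s = ?f (s * h, e * s * e, h * s)"
      by (simp only: case_prod_conv)
    moreover have "s * h * e = s * h" "e * (s * h) = e"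
      using h by (simp only: mult.assoc) (simp only: h(3) mult.assoc[symmetric])
    moreover have "e * (h * s) = h * s" "h * s * e = e"
      using h by (simp_all only: mult.assoc[symmetric])
    ultimately show "s \<in> ?f ` (?A \<times> ?G \<times> ?B)"
      by (intro image_eqI[of s ?f "(s * h, e * s * e, h * s)"]) blast+
  qed
  then have "UNIV = ?f ` (?A \<times> ?G \<times> ?B)"
    by (rule UNIV_eq_I)
  ultimately have "card (UNIV :: 'a set) = card (?A \<times> ?G \<times> ?B)"
    using card_image[of ?f "?A \<times> ?G \<times> ?B"] by simp
  then show ?thesis
    by (simp add: card_cartesian_product)
qed

section \<open>Groups of prime order\<close>

text \<open>Any \<open>x \<noteq> \<one>\<close> has a centralizer containing \<open>\<one>\<close> and \<open>x\<close>, hence of order \<open>p\<close>.\<close>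

lemma (in group) prime_order_commute:
  assumes prime: "prime (order G)" and x: "x \<in> carrier G" and y: "y \<in> carrier G"
  shows "x \<otimes> y = y \<otimes> x"
proof (cases "x = \<one>")
  case False
  let ?C = "{z \<in> carrier G. x \<otimes> z = z \<otimes> x}"
  have "subgroup ?C G"
  proof
    fix z assume "z \<in> ?C"
    then have z: "z \<in> carrier G" "x \<otimes> z = z \<otimes> x"
      by auto
    then have "x \<otimes> inv z = inv z \<otimes> (z \<otimes> x) \<otimes> inv z"
      using x by (simp add: m_assoc[symmetric])
    also have "\<dots> = inv z \<otimes> x"
      unfolding z(2)[symmetric] using x z(1) by (simp add: m_assoc)
    finally show "inv z \<in> ?C"
      using z by simp
  next
    fix z w assume "z \<in> ?C" "w \<in> ?C"
    then show "z \<otimes> w \<in> ?C"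
      using x by simp (metis m_assoc)
  qed (use x in auto)
  then have "card ?C dvd order G"
    using lagrange by (metis dvd_triv_right)
  have fin: "finite (carrier G)"
    using prime_gt_0_nat[OF prime] order_gt_0_iff_finite by simp
  have "card {\<one>, x} \<le> card ?C"
    by (rule card_mono) (use fin x in auto)
  then have "card ?C \<noteq> 1"
    using False by auto
  then have "card ?C = order G"
    using \<open>card ?C dvd order G\<close> prime unfolding prime_nat_iff by blast
  then have "?C = carrier G"
    using fin by (intro card_subset_eq) (auto simp: order_def)
  then show ?thesis
    using y by blast
qed (use y in simp)

text \<open>A left identity with left inverses already makes an associative operation a
  group.\<close>

lemma commutative_if_prime_group:
  fixes e x y :: "'a::semigroup_mult"
  assumes "prime (card (UNIV :: 'a set))"
    and "\<And>s. e * s = s" and "\<And>s. \<exists>h. h * s = e"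
  shows "x * y = y * x"
proof -
  define S :: "'a monoid" where "S = \<lparr>carrier = UNIV, monoid.mult = (*), one = e\<rparr>"
  have "group S"
    by (rule groupI) (use assms in \<open>auto simp: S_def mult.assoc\<close>)
  then show ?thesis
    using group.prime_order_commute[of S x y] assms(1) by (simp add: S_def order_def)
qed

section \<open>Connected graphs of prime order\<close>

lemma complete_graph_if_prime_card:
  assumes prime: "prime (card (UNIV :: 'a::semigroup_mult set))"
    and conn: "Digraph_Component.connected
      (with_proj (lower_non_nilpotent_graph :: 'a pair_pre_digraph))"
  shows "complete_graph (with_proj (lower_non_nilpotent_graph :: 'a pair_pre_digraph))"
proof -
  have fin: "finite (UNIV :: 'a set)"
    using prime by (metis card.infinite not_prime_0)
  obtain e :: 'a where e: "e * e = e"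
    and inv: "\<And>s. \<exists>h. e * h = h \<and> h * e = h \<and> e * s * h = e \<and> h * s * e = e"
    using finite_semigroup_local_group[OF fin] by metis
  have simple: "\<exists>a b. s = a * e * b" for s
  proof -
    let ?J = "{a * e * b | a b. True}"
    have "e = e * e * e"
      by (simp add: e)
    then have "e \<in> ?J"
      by blast
    \<comment> \<open>Edges do not leave an ideal, so connectedness spreads membership from
      \<open>e\<close> to all of \<open>S\<close>.\<close>
    with conn have "s \<in> ?J"
      by (rule connected_induct[where P = "\<lambda>s. s \<in> ?J"])
        (rule lower_adjacent_ideal[OF _ semigroup_ideal_principal])
    then show ?thesis
      by blast
  qed
  let ?G = "range (\<lambda>s. e * s * e)"
  have "card ?G = 1 \<or> card ?G = card (UNIV :: 'a set)"
    using local_group_card_dvd[OF e inv simple] prime prime_nat_iff by blast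
  then show ?thesis
  proof
    assume "card ?G = 1"
    then have "e * s * e = e" for s
      by (metis card_1_singletonE rangeI singletonD e)
    then show ?thesis
      using rectangular_if_local_trivial[OF _ simple] complete_graph_if_rectangular by blast
  next
    assume "card ?G = card (UNIV :: 'a set)"
    then have "?G = UNIV"
      using fin by (simp add: card_subset_eq)
    then have G: "\<exists>t. s = e * t * e" for s
      by blast
    \<comment> \<open>As every \<open>s\<close> has the form \<open>e * t * e\<close>, the
      idempotent \<open>e\<close> is an identity of \<open>S\<close>.\<close>
    have one: "e * s = s" "s * e = s" for s
      using G[of s] e by (auto simp: mult.assoc) (simp add: mult.assoc[symmetric])
    have "\<exists>h. h * s = e" for s
      using inv[of s] one by (metis mult.assoc)
    then have comm: "x * y = y * x" for x y :: 'a
      using commutative_if_prime_group[OF prime one(1)] by blast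
    \<comment> \<open>Without edges, equality with \<open>x\<close> is vacuously preserved along
      edges, so connectedness leaves a single vertex.\<close>
    have "x = y" for x y :: 'a
      using conn refl[of x]
      by (rule connected_induct[where P = "(=) x"])
        (simp add: not_lower_adjacent_if_commutative[OF comm])
    then show ?thesis
      by (auto simp: complete_graph_def)
  qed
qed

theorem proposition3p2:
  fixes I :: "'i set" and \<Lambda> :: "'l set" and e :: 'g and P :: "'l \<Rightarrow> 'i \<Rightarrow> 'g"
  shows
    "(completely_simple TYPE('a::semigroup_mult) \<and> band TYPE('a) \<longrightarrow>
        complete_graph (with_proj (lower_non_nilpotent_graph :: 'a pair_pre_digraph))) \<and>
     (I \<noteq> {} \<and> \<Lambda> \<noteq> {} \<and> (\<forall>j\<in>\<Lambda>. \<forall>i\<in>I. P j i = e) \<and>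
        isomorphic_to_rees TYPE('a) (singleton_group e) I \<Lambda> P \<longrightarrow>
        complete_graph (with_proj (lower_non_nilpotent_graph :: 'a pair_pre_digraph))) \<and>
     (prime (card (UNIV :: 'a set)) \<and>
        Digraph_Component.connected
          (with_proj (lower_non_nilpotent_graph :: 'a pair_pre_digraph)) \<longrightarrow>
        complete_graph (with_proj (lower_non_nilpotent_graph :: 'a pair_pre_digraph)))"
proof (intro conjI impI; elim conjE)
  assume "completely_simple TYPE('a)" "band TYPE('a)"
  then show "complete_graph (with_proj (lower_non_nilpotent_graph :: 'a pair_pre_digraph))"
    by (intro complete_graph_if_rectangular rectangular_if_completely_simple_band)
next
  assume "isomorphic_to_rees TYPE('a) (singleton_group e) I \<Lambda> P"
  then show "complete_graph (with_proj (lower_non_nilpotent_graph :: 'a pair_pre_digraph))"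
    by (intro complete_graph_if_rectangular rectangular_if_trivial_rees)
qed (rule complete_graph_if_prime_card)

end
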